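(* For $n\geq 6$, $a_n(231;231) = n$.
   Context: $\mathcal{S}_n$ is the set of permutations of $[n]=\{1,\dots,n\}$, written in one-line notation $\pi=\pi_1\pi_2\cdots\pi_n$ with $\pi_i=\pi(i)$. A permutation is cyclic if it consists of exactly one $n$-cycle. For a cyclic $\pi$, its standard cycle notation is $C(\pi)=(c_1,c_2,\dots,c_n)$ with $c_1=1$ and $c_i=\pi_{c_{i-1}}$ for $2\le i\le n$. A sequence of distinct integers $w_1\cdots w_m$ contains a pattern $\sigma\in\mathcal{S}_k$ if there are indices $i_1<\dots<i_k$ with $w_{i_1}\cdots w_{i_k}$ in the same relative order as $\sigma_1\cdots\sigma_k$; otherwise it avoids $\sigma$. For $\sigma,\tau\in\mathcal{S}_3$, $\mathcal{A}_n(\sigma;\tau)$ is the set of cyclic permutations $\pi\in\mathcal{S}_n$ whose one-line notation avoids $\sigma$ and whose cycle notation $C(\pi)$ (as the sequence $c_1c_2\cdots c_n$) avoids $\tau$; $a_n(\sigma;\tau)=|\mathcal{A}_n(\sigma;\tau)|$. *)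

theory Defs
  imports "HOL-Combinatorics.Combinatorics"
begin

definition contains_pattern :: "nat list \<Rightarrow> nat list \<Rightarrow> bool" where
  "contains_pattern w \<sigma> \<longleftrightarrow>
     (\<exists>f :: nat \<Rightarrow> nat. strict_mono_on {..<length \<sigma>} f \<and> f ` {..<length \<sigma>} \<subseteq> {..<length w} \<and>
        (\<forall>a<length \<sigma>. \<forall>b<length \<sigma>. w ! f a < w ! f b \<longleftrightarrow> \<sigma> ! a < \<sigma> ! b))"

abbreviation avoids_pattern :: "nat list \<Rightarrow> nat list \<Rightarrow> bool" where
  "avoids_pattern w \<sigma> \<equiv> \<not> contains_pattern w \<sigma>"

definition one_line :: "nat \<Rightarrow> (nat \<Rightarrow> nat) \<Rightarrow> nat list" where
  "one_line n \<pi> = map \<pi> [1..<Suc n]"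

text \<open>The permutation is a single \<open>n\<close>-cycle when \<open>{1..n}\<close> is one orbit of it.\<close>

definition cyclic_perm :: "nat \<Rightarrow> (nat \<Rightarrow> nat) \<Rightarrow> bool" where
  "cyclic_perm n \<pi> \<longleftrightarrow> \<pi> permutes {1..n} \<and> cyclic_on \<pi> {1..n}"

text \<open>The sequence \<open>1, \<pi> 1, \<pi> (\<pi> 1), \<dots>\<close> of length \<open>n\<close>; list position \<open>i\<close>, counted from \<open>0\<close>,
  holds \<open>c\<^sub>i\<^sub>+\<^sub>1\<close>.\<close>

definition cycle_notation :: "nat \<Rightarrow> (nat \<Rightarrow> nat) \<Rightarrow> nat list" where
  "cycle_notation n \<pi> = map (\<lambda>i. (\<pi> ^^ i) 1) [0..<n]"

text \<open>The patterns \<open>\<sigma>\<close> and \<open>\<tau>\<close> are given in one-line notation. Elements of the set fix every number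
  outside \<open>{1..n}\<close>, so its cardinality counts each permutation of \<open>{1..n}\<close> once.\<close>

definition avoiding_cyclic :: "nat \<Rightarrow> nat list \<Rightarrow> nat list \<Rightarrow> (nat \<Rightarrow> nat) set" where
  "avoiding_cyclic n \<sigma> \<tau> =
     {\<pi>. cyclic_perm n \<pi> \<and> avoids_pattern (one_line n \<pi>) \<sigma> \<and> avoids_pattern (cycle_notation n \<pi>) \<tau>}"

definition num_avoiding_cyclic :: "nat \<Rightarrow> nat list \<Rightarrow> nat list \<Rightarrow> nat" where
  "num_avoiding_cyclic n \<sigma> \<tau> = card (avoiding_cyclic n \<sigma> \<tau>)"

end

theory Submission
  imports Defs
begin

text \<open>In a cyclic permutation avoiding \<open>231\<close> the first entry is \<open>n\<close>, since otherwise the positions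
  before \<open>n\<close> form an invariant set. Inserting \<open>n + 1\<close> right after \<open>1\<close> in the cycle therefore
  identifies the avoiders of size \<open>n\<close> with the avoiders \<open>\<rho>\<close> of size \<open>n + 1\<close> with \<open>\<rho> (n + 1) = n\<close>.
  Every other avoider of size \<open>n \<ge> 4\<close> ends in \<open>2\<close>, up to the two exceptions \<open>54213\<close> and
  \<open>652143\<close>, and the only avoider ending in \<open>2\<close> is the one with cycle
  \<open>(1, n, 2, n - 1, 3, n - 2, \<dots>)\<close>. There is one avoider of size \<open>3\<close>, and each
  later size adds one permutation, with one more at \<open>n = 5\<close> and \<open>n = 6\<close>.\<close>

section \<open>The pattern 231 as a condition on index triples\<close>

lemma contains_pattern_231_iff:
  "contains_pattern w [2, 3, 1] \<longleftrightarrow>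
     (\<exists>i j l. i < j \<and> j < l \<and> l < length w \<and> w ! l < w ! i \<and> w ! i < w ! j)"
proof
  assume "contains_pattern w [2, 3, 1]"
  then obtain f where f: "strict_mono_on {..<3} f" "f ` {..<3} \<subseteq> {..<length w}"
    and ord: "\<And>a b. a < 3 \<Longrightarrow> b < 3 \<Longrightarrow>
      w ! f a < w ! f b \<longleftrightarrow> [2, 3, 1 :: nat] ! a < [2, 3, 1] ! b"
    unfolding contains_pattern_def by (auto simp: numeral_eq_Suc)
  have "f 0 < f 1" "f 1 < f 2"
    using f(1) by (auto simp: strict_mono_on_def)
  moreover have "f 2 < length w"
    using f(2) by (auto simp: image_subset_iff)
  moreover have "w ! f 2 < w ! f 0" "w ! f 0 < w ! f 1"
    using ord[of 2 0] ord[of 0 1] by auto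
  ultimately show "\<exists>i j l. i < j \<and> j < l \<and> l < length w \<and> w ! l < w ! i \<and> w ! i < w ! j"
    by blast
next
  assume "\<exists>i j l. i < j \<and> j < l \<and> l < length w \<and> w ! l < w ! i \<and> w ! i < w ! j"
  then obtain i j l where ijl: "i < j" "j < l" "l < length w" "w ! l < w ! i" "w ! i < w ! j"
    by blast
  define f where "f = (\<lambda>a :: nat. if a = 0 then i else if a = 1 then j else l)"
  have three: "{..<length [2, 3, 1 :: nat]} = {0, 1, 2}"
    by auto
  have "strict_mono_on {0, 1, 2} f" "f ` {0, 1, 2} \<subseteq> {..<length w}"
    using ijl by (auto simp: f_def strict_mono_on_def)
  moreover have "w ! f a < w ! f b \<longleftrightarrow> [2, 3, 1 :: nat] ! a < [2, 3, 1] ! b"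
    if "a < 3" "b < 3" for a b
  proof -
    have "a = 0 \<or> a = 1 \<or> a = 2" "b = 0 \<or> b = 1 \<or> b = 2"
      using that by auto
    then show ?thesis
      using ijl by (auto simp: f_def)
  qed
  ultimately show "contains_pattern w [2, 3, 1]"
    unfolding contains_pattern_def three by (intro exI[of _ f]) auto
qed

text \<open>One predicate over an index set serves both words: the one-line notation on
  \<open>{1..n}\<close> and the cycle sequence on \<open>{..<n}\<close>. It is phrased as an
  implication so that it applies directly to an ascent.\<close>

definition avoids231_on :: "nat set \<Rightarrow> (nat \<Rightarrow> nat) \<Rightarrow> bool" where
  "avoids231_on S f \<longleftrightarrow>
     (\<forall>i\<in>S. \<forall>j\<in>S. \<forall>l\<in>S. i < j \<longrightarrow> j < l \<longrightarrow> f i < f j \<longrightarrow> f i \<le> f l)"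

lemma avoids231_onD:
  "avoids231_on S f \<Longrightarrow> i < j \<Longrightarrow> j < l \<Longrightarrow> i \<in> S \<Longrightarrow> j \<in> S \<Longrightarrow> l \<in> S \<Longrightarrow> f i < f j \<Longrightarrow> f i \<le> f l"
  unfolding avoids231_on_def by blast

lemma avoids_pattern_map_231:
  "avoids_pattern (map f [0..<n]) [2, 3, 1] \<longleftrightarrow> avoids231_on {..<n} f"
proof -
  have "contains_pattern (map f [0..<n]) [2, 3, 1] \<longleftrightarrow>
    (\<exists>i j l. i < j \<and> j < l \<and> l < n \<and> f l < f i \<and> f i < f j)"
    unfolding contains_pattern_231_iff by (intro ex_cong1) auto
  also have "\<dots> \<longleftrightarrow> \<not> avoids231_on {..<n} f"
    unfolding avoids231_on_def by (simp add: not_le Bex_def) (meson less_trans)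
  finally show ?thesis by blast
qed

lemma avoids_one_line_231:
  "avoids_pattern (one_line n \<pi>) [2, 3, 1] \<longleftrightarrow> avoids231_on {1..n} \<pi>"
proof -
  have "one_line n \<pi> = map (\<lambda>i. \<pi> (Suc i)) [0..<n]"
    unfolding one_line_def by (simp add: list_eq_iff_nth_eq del: upt_Suc)
  moreover have "{1..n} = Suc ` {..<n}"
    by (auto simp: image_Suc_lessThan)
  then have "avoids231_on {1..n} \<pi> \<longleftrightarrow> avoids231_on {..<n} (\<lambda>i. \<pi> (Suc i))"
    unfolding avoids231_on_def by simp
  ultimately show ?thesis
    by (simp only: avoids_pattern_map_231)
qed

lemma avoids_cycle_notation_231:
  "avoids_pattern (cycle_notation n \<pi>) [2, 3, 1] \<longleftrightarrow> avoids231_on {..<n} (\<lambda>i. (\<pi> ^^ i) 1)"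
  unfolding cycle_notation_def by (rule avoids_pattern_map_231)

definition avoiders :: "nat \<Rightarrow> (nat \<Rightarrow> nat) set" where
  "avoiders n = avoiding_cyclic n [2, 3, 1] [2, 3, 1]"

lemma mem_avoiders_iff:
  "\<pi> \<in> avoiders n \<longleftrightarrow> cyclic_perm n \<pi> \<and> avoids231_on {1..n} \<pi> \<and>
     avoids231_on {..<n} (\<lambda>i. (\<pi> ^^ i) 1)"
  unfolding avoiders_def avoiding_cyclic_def avoids_one_line_231 avoids_cycle_notation_231 by simp

section \<open>Cyclicity, invariant sets and the cycle sequence\<close>

text \<open>For a permutation of a finite set the orbit of 1 consists of all iterates, the zeroth
  included, so an explicit permutation is cyclic once its iterates reach every element.\<close>

lemma cyclic_permI:
  assumes "\<pi> permutes {1..n}" "n \<ge> 1" "{1..n} \<subseteq> range (\<lambda>i. (\<pi> ^^ i) 1)"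
  shows "cyclic_perm n \<pi>"
proof -
  have "permutation \<pi>"
    using assms(1) by (auto simp: permutation_permutes)
  then have "{1..n} \<subseteq> orbit \<pi> 1"
    using assms(3) by (auto simp: orbit_altdef_permutation)
  moreover have "orbit \<pi> 1 \<subseteq> {1..n}"
    using assms by (intro permutes_orbit_subset) auto
  ultimately show ?thesis
    unfolding cyclic_perm_def cyclic_on_def using assms by (auto intro!: bexI[of _ 1])
qed

text \<open>The orbit of a point of \<open>A\<close> stays in \<open>A\<close>, yet it is
  everything. Cyclicity is contradicted below by exhibiting a proper invariant set.\<close>

lemma cyclic_perm_invariant_set:
  assumes "cyclic_perm n \<pi>" "A \<subseteq> {1..n}" "A \<noteq> {}" "\<pi> ` A \<subseteq> A"
  shows "A = {1..n}"
proof -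
  obtain a where "a \<in> A" using assms(3) by blast
  then have "orbit \<pi> a = {1..n}"
    using assms by (intro orbit_cyclic_eq3) (auto simp: cyclic_perm_def)
  moreover have "x \<in> A" if "x \<in> orbit \<pi> a" for x
    using that by induction (use \<open>a \<in> A\<close> assms(4) in auto)
  ultimately show ?thesis using assms(2) by blast
qed

text \<open>The orbit of 1 is itself nonempty and invariant.\<close>

lemma cyclic_perm_if_invariant_sets:
  assumes "\<pi> permutes {1..n}" "n \<ge> 1"
    and "\<And>A. A \<subseteq> {1..n} \<Longrightarrow> A \<noteq> {} \<Longrightarrow> \<pi> ` A \<subseteq> A \<Longrightarrow> A = {1..n}"
  shows "cyclic_perm n \<pi>"
proof -
  have "orbit \<pi> 1 = {1..n}"
  proof (rule assms(3))
    show "orbit \<pi> 1 \<subseteq> {1..n}"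
      using assms by (intro permutes_orbit_subset) auto
  qed (auto simp: orbit_nonempty intro: orbit.intros)
  then show ?thesis
    unfolding cyclic_perm_def cyclic_on_def using assms by (auto intro!: bexI[of _ 1])
qed

locale cyclic_permutation =
  fixes n :: nat and \<pi> :: "nat \<Rightarrow> nat"
  assumes cyclic: "cyclic_perm n \<pi>" and n_pos: "n \<ge> 1"
begin

definition c :: "nat \<Rightarrow> nat" where
  "c i = (\<pi> ^^ i) 1"

lemma perm: "\<pi> permutes {1..n}"
  using cyclic by (simp add: cyclic_perm_def)

lemma c_0 [simp]: "c 0 = 1"
  by (simp add: c_def)

lemma c_Suc: "c (Suc i) = \<pi> (c i)"
  by (simp add: c_def)

lemma orbit_1: "orbit \<pi> 1 = {1..n}"
  using cyclic n_pos by (intro orbit_cyclic_eq3) (auto simp: cyclic_perm_def)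

text \<open>Before the first return to 1 the iterates are distinct and fill the orbit, so the return
  time is the orbit size. This yields that \<open>c\<close> maps \<open>{..<n}\<close> bijectively
  to \<open>{1..n}\<close> and that \<open>c n = 1\<close>.\<close>

lemma dist_1: "funpow_dist1 \<pi> 1 1 = n"
proof -
  have 1: "1 \<in> orbit \<pi> 1" using orbit_1 n_pos by simp
  have "card {1..n} = card {0..<funpow_dist1 \<pi> 1 1}"
    unfolding orbit_1[symmetric] orbit_conv_funpow_dist1[OF 1]
    by (rule card_image[OF inj_on_funpow_dist1[OF 1]])
  then show ?thesis by simp
qed

lemma c_n: "c n = 1"
  using funpow_dist1_prop[of 1 \<pi> 1] orbit_1 n_pos unfolding dist_1 c_def by simp

lemma c_image: "c ` {..<n} = {1..n}"
  using orbit_conv_funpow_dist1[of 1 \<pi>] orbit_1 n_pos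
  unfolding dist_1 c_def by (simp add: lessThan_atLeast0)

lemma inj_on_c: "inj_on c {..<n}"
  by (rule eq_card_imp_inj_on) (simp_all add: c_image)

lemma c_eq_iff: "i < n \<Longrightarrow> j < n \<Longrightarrow> c i = c j \<longleftrightarrow> i = j"
  using inj_on_c by (auto simp: inj_on_def)

lemma c_in: "i < n \<Longrightarrow> 1 \<le> c i \<and> c i \<le> n"
  using c_image by auto

lemma c_ex: "1 \<le> x \<Longrightarrow> x \<le> n \<Longrightarrow> \<exists>i<n. c i = x"
  using c_image by (metis atLeastAtMost_iff imageE lessThan_iff)

lemma pi_in: "1 \<le> x \<Longrightarrow> x \<le> n \<Longrightarrow> 1 \<le> \<pi> x \<and> \<pi> x \<le> n"
  using permutes_in_image[OF perm, of x] by simp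

lemma pi_eq_iff: "\<pi> x = \<pi> y \<longleftrightarrow> x = y"
  using permutes_inj[OF perm] by (simp add: inj_eq)

lemma pi_ex: "1 \<le> y \<Longrightarrow> y \<le> n \<Longrightarrow> \<exists>x. 1 \<le> x \<and> x \<le> n \<and> \<pi> x = y"
  using permutes_image[OF perm] by (metis atLeastAtMost_iff imageE)

lemma invariant_set: "A \<subseteq> {1..n} \<Longrightarrow> A \<noteq> {} \<Longrightarrow> \<pi> ` A \<subseteq> A \<Longrightarrow> A = {1..n}"
  using cyclic_perm_invariant_set[OF cyclic] .

end

section \<open>The first entry of a 231-avoiding cyclic permutation\<close>

text \<open>Otherwise the positions before the maximum would form an invariant set.\<close>

lemma avoids231_cyclic_1:
  assumes "cyclic_perm n \<pi>" "avoids231_on {1..n} \<pi>" "n \<ge> 1"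
  shows "\<pi> 1 = n"
proof -
  interpret cyclic_permutation n \<pi>
    using assms by unfold_locales
  obtain p where p: "1 \<le> p" "p \<le> n" "\<pi> p = n"
    using pi_ex[of n] n_pos by auto
  have below: "\<pi> i \<le> \<pi> l" if "1 \<le> i" "i < p" "p < l" "l \<le> n" for i l
  proof -
    have "\<pi> i < \<pi> p"
      using pi_in[of i] pi_eq_iff[of i p] that p by simp
    then show ?thesis
      using avoids231_onD[OF assms(2), of i p l] that p by simp
  qed
  have "p = 1"
  proof (rule ccontr)
    assume "p \<noteq> 1"
    define B where "B = \<pi> ` {1..<p}"
    \<comment> \<open>By \<open>below\<close>, a value smaller than one in \<open>B\<close> cannot
      occur after position \<open>p\<close>, so \<open>B\<close> is downward closed.\<close>
    have down: "u \<in> B" if uv: "v \<in> B" "1 \<le> u" "u \<le> v" for u v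
    proof -
      obtain i where i: "1 \<le> i" "i < p" "\<pi> i = v"
        using uv(1) by (auto simp: B_def)
      have "v < n" using i p pi_in[of i] pi_eq_iff[of i p] by simp
      obtain l where l: "1 \<le> l" "l \<le> n" "\<pi> l = u"
        using pi_ex[of u] uv \<open>v < n\<close> by auto
      have "\<not> p < l"
        using below[of i l] i l that pi_eq_iff[of i l] p by auto
      moreover have "l \<noteq> p" using l p that \<open>v < n\<close> by auto
      ultimately show ?thesis using l by (auto simp: B_def)
    qed
    have card: "card B = p - 1"
      unfolding B_def by (subst card_image) (auto simp: inj_on_def pi_eq_iff)
    have fin: "finite B" by (simp add: B_def)
    \<comment> \<open>A downward closed set of \<open>p - 1\<close> positive values can only be
      \<open>{1..<p}\<close>, which makes the positions before \<open>p\<close> invariant.\<close>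
    have "B \<subseteq> {1..<p}"
    proof
      fix v assume v: "v \<in> B"
      then obtain i where "1 \<le> i" "i < p" "v = \<pi> i" by (auto simp: B_def)
      then have "1 \<le> v" using pi_in[of i] p by simp
      have "{1..v} \<subseteq> B" using down[OF v] by auto
      then have "v \<le> p - 1" using card_mono[OF fin, of "{1..v}"] card by simp
      then show "v \<in> {1..<p}" using \<open>1 \<le> v\<close> p \<open>p \<noteq> 1\<close> by auto
    qed
    then have "{1..<p} = {1..n}"
      using p \<open>p \<noteq> 1\<close> by (intro invariant_set) (auto simp: B_def)
    then have "p \<in> {1..<p}" using p by simp
    then show False by simp
  qed
  with p show ?thesis by simp
qed

section \<open>Inserting the maximum right after 1 in the cycle\<close>

text \<open>\<open>\<pi> \<circ> transpose 1 (n + 1)\<close> inserts \<open>n + 1\<close> right after \<open>1\<close> into the cycle.\<close>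

lemma insert_max_simps:
  assumes "\<pi> permutes {1..n}" "n \<ge> 1"
  shows "(\<pi> \<circ> transpose 1 (Suc n)) 1 = Suc n" "(\<pi> \<circ> transpose 1 (Suc n)) (Suc n) = \<pi> 1"
    "x \<noteq> 1 \<Longrightarrow> x \<noteq> Suc n \<Longrightarrow> (\<pi> \<circ> transpose 1 (Suc n)) x = \<pi> x"
  using assms permutes_not_in[OF assms(1), of "Suc n"] by auto

text \<open>The only change is the detour from 1 through \<open>Suc n\<close> to
  \<open>\<pi> 1\<close>, so an invariant set of the new map meets \<open>{1..n}\<close> in an
  invariant set of \<open>\<pi>\<close>.\<close>

lemma cyclic_perm_insert_max:
  assumes "cyclic_perm n \<pi>" "n \<ge> 1"
  shows "cyclic_perm (Suc n) (\<pi> \<circ> transpose 1 (Suc n))"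
proof (rule cyclic_perm_if_invariant_sets)
  interpret cyclic_permutation n \<pi>
    using assms by unfold_locales
  note simps = insert_max_simps[OF perm n_pos]
  show "\<pi> \<circ> transpose 1 (Suc n) permutes {1..Suc n}"
    using perm n_pos
    by (intro permutes_compose permutes_swap_id) (auto intro: permutes_subset)
  fix A assume A: "A \<subseteq> {1..Suc n}" "A \<noteq> {}" "(\<pi> \<circ> transpose 1 (Suc n)) ` A \<subseteq> A"
  have step: "(\<pi> \<circ> transpose 1 (Suc n)) x \<in> A" if "x \<in> A" for x
    using A(3) that by blast
  have pos: "\<pi> 1 \<le> n" "\<pi> 1 \<ge> 1" using pi_in[of 1] n_pos by auto
  have last: "\<pi> 1 \<in> A" if "Suc n \<in> A"
    using step[OF that] simps(2) by simp
  have "A \<inter> {1..n} = {1..n}"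
  proof (rule invariant_set)
    show "A \<inter> {1..n} \<noteq> {}"
    proof -
      obtain a where a: "a \<in> A" using A(2) by blast
      show ?thesis
      proof (cases "a = Suc n")
        case True
        then show ?thesis using last a pos by auto
      next
        case False
        then have "a \<in> {1..n}" using a A(1) by force
        then show ?thesis using a by blast
      qed
    qed
    show "\<pi> ` (A \<inter> {1..n}) \<subseteq> A \<inter> {1..n}"
    proof
      fix y assume "y \<in> \<pi> ` (A \<inter> {1..n})"
      then obtain x where x: "x \<in> A" "1 \<le> x" "x \<le> n" "y = \<pi> x" by auto
      have "\<pi> x \<in> A"
      proof (cases "x = 1")
        case True
        then show ?thesis using step[OF x(1)] simps(1) last by simp
      next
        case False
        then show ?thesis using step[OF x(1)] simps(3)[of x] x by simp
      qed
      then show "y \<in> A \<inter> {1..n}" using x pi_in[of x] by simp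
    qed
  qed auto
  then have sub: "{1..n} \<subseteq> A" by blast
  then have "1 \<in> A" using n_pos by auto
  then have "Suc n \<in> A" using step[of 1] simps(1) by simp
  then show "A = {1..Suc n}" using sub A(1) by (auto simp: le_Suc_eq)
qed simp

text \<open>An invariant set of the shortened cycle becomes invariant for \<open>\<rho>\<close> when
  \<open>Suc n\<close> is added exactly if 1 belongs to it.\<close>

lemma cyclic_perm_delete_max:
  assumes cyc: "cyclic_perm (Suc n) \<rho>" and n: "n \<ge> 1" and r1: "\<rho> 1 = Suc n"
  shows "cyclic_perm n (\<rho> \<circ> transpose 1 (Suc n))"
proof (rule cyclic_perm_if_invariant_sets)
  interpret cyclic_permutation "Suc n" \<rho>
    using assms by unfold_locales auto
  let ?\<pi> = "\<rho> \<circ> transpose 1 (Suc n)"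
  have "?\<pi> permutes {1..Suc n}"
    using perm by (intro permutes_compose permutes_swap_id) auto
  moreover have "?\<pi> (Suc n) = Suc n"
    using r1 by simp
  ultimately show p: "?\<pi> permutes {1..n}"
    by (rule_tac permutes_superset) (auto simp: le_Suc_eq)
  fix A assume A: "A \<subseteq> {1..n}" "A \<noteq> {}" "?\<pi> ` A \<subseteq> A"
  have step: "?\<pi> x \<in> A" if "x \<in> A" for x
    using A(3) that by blast
  define A' where "A' = (if 1 \<in> A then insert (Suc n) A else A)"
  have "A' = {1..Suc n}"
  proof (rule invariant_set)
    show "A' \<subseteq> {1..Suc n}" "A' \<noteq> {}"
      using A by (auto simp: A'_def)
    show "\<rho> ` A' \<subseteq> A'"
    proof
      fix y assume "y \<in> \<rho> ` A'"
      then obtain x where x: "x \<in> A'" "y = \<rho> x" by blast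
      consider "x = 1" | "x = Suc n" | "x \<noteq> 1" "x \<noteq> Suc n" by blast
      then show "y \<in> A'"
      proof cases
        case 1
        then show ?thesis using x r1 n by (auto simp: A'_def split: if_splits)
      next
        case 2
        then have "1 \<in> A" using x A(1) by (auto simp: A'_def split: if_splits)
        then show ?thesis using step[of 1] x 2 by (auto simp: A'_def)
      next
        case 3
        then have "x \<in> A" using x by (auto simp: A'_def split: if_splits)
        then show ?thesis using step[of x] x 3 by (auto simp: A'_def)
      qed
    qed
  qed
  then have "{1..Suc n} \<subseteq> insert (Suc n) A" by (auto simp: A'_def split: if_splits)
  then show "A = {1..n}" using A(1) by force
qed (rule n)

text \<open>The new word replaces the first entry \<open>n\<close> by \<open>n + 1\<close> and
  appends \<open>n\<close>. A maximal first entry cannot start a 231, and the appended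
  \<open>n\<close> exceeds everything between, so it cannot end one.\<close>

lemma avoids231_insert_max:
  assumes "\<pi> permutes {1..n}" "n \<ge> 1" "\<pi> 1 = n"
  shows "avoids231_on {1..Suc n} (\<pi> \<circ> transpose 1 (Suc n)) \<longleftrightarrow> avoids231_on {1..n} \<pi>"
proof -
  let ?\<rho> = "\<pi> \<circ> transpose 1 (Suc n)"
  note simps = insert_max_simps[OF assms(1,2)]
  have le: "\<pi> x \<le> n" if "x \<in> {1..n}" for x
    using permutes_in_image[OF assms(1), of x] that by simp
  show ?thesis
  proof
    assume L: "avoids231_on {1..Suc n} ?\<rho>"
    show "avoids231_on {1..n} \<pi>"
      unfolding avoids231_on_def
    proof (intro ballI impI)
      fix i j l assume *: "i \<in> {1..n}" "j \<in> {1..n}" "l \<in> {1..n}" "i < j" "j < l" "\<pi> i < \<pi> j"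
      have "i \<noteq> 1" using * le[of j] assms(3) by auto
      then show "\<pi> i \<le> \<pi> l"
        using avoids231_onD[OF L, of i j l] * simps(3)[of i] simps(3)[of j] simps(3)[of l] by simp
    qed
  next
    assume R: "avoids231_on {1..n} \<pi>"
    show "avoids231_on {1..Suc n} ?\<rho>"
      unfolding avoids231_on_def
    proof (intro ballI impI)
      fix i j l assume *: "i \<in> {1..Suc n}" "j \<in> {1..Suc n}" "l \<in> {1..Suc n}"
        "i < j" "j < l" "?\<rho> i < ?\<rho> j"
      have j: "?\<rho> j = \<pi> j" "j \<in> {1..n}" using * simps(3)[of j] by auto
      have "i \<noteq> 1" using * le[of j] j simps(1) by auto
      then have i: "?\<rho> i = \<pi> i" "i \<in> {1..n}" using * simps(3)[of i] by auto
      show "?\<rho> i \<le> ?\<rho> l"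
      proof (cases "l = Suc n")
        case True
        then show ?thesis using i simps(2) le[of i] assms(3) by simp
      next
        case False
        then have "?\<rho> l = \<pi> l" "l \<in> {1..n}" using * simps(3)[of l] by auto
        then show ?thesis using avoids231_onD[OF R, of i j l] * i j by simp
      qed
    qed
  qed
qed

text \<open>The new entry occupies index 1, which delays all later entries by one step.\<close>

lemma funpow_insert_max:
  assumes "cyclic_perm n \<pi>" "1 \<le> i" "i \<le> n"
  shows "((\<pi> \<circ> transpose 1 (Suc n)) ^^ Suc i) 1 = (\<pi> ^^ i) 1"
  using assms(2,3)
proof (induction i rule: dec_induct)
  interpret cyclic_permutation n \<pi>
    using assms by unfold_locales auto
  note simps = insert_max_simps[OF perm n_pos]
  let ?\<rho> = "\<pi> \<circ> transpose 1 (Suc n)"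
  {
    case base
    have "(?\<rho> ^^ Suc 1) 1 = ?\<rho> (?\<rho> 1)" by simp
    then show ?case using simps(1,2) by simp
  next
    case (step i)
    have "(\<pi> ^^ i) 1 \<noteq> 1" "(\<pi> ^^ i) 1 \<noteq> Suc n"
      using c_eq_iff[of i 0] c_in[of i] step by (auto simp: c_def)
    moreover have "(?\<rho> ^^ Suc (Suc i)) 1 = ?\<rho> ((?\<rho> ^^ Suc i) 1)"
      by simp
    ultimately show ?case using simps(3)[of "(\<pi> ^^ i) 1"] step by simp
  }
qed

text \<open>The cycle sequence becomes \<open>1, n + 1, c 1, c 2, \<dots>\<close>. Neither the
  minimum 1 nor the maximum \<open>n + 1\<close> can play the 2 of a 231, and both precede the
  rest.\<close>

lemma avoids231_cycle_insert_max:
  assumes "cyclic_perm n \<pi>" "n \<ge> 1"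
  shows "avoids231_on {..<Suc n} (\<lambda>i. ((\<pi> \<circ> transpose 1 (Suc n)) ^^ i) 1) \<longleftrightarrow>
    avoids231_on {..<n} (\<lambda>i. (\<pi> ^^ i) 1)"
proof -
  interpret cyclic_permutation n \<pi>
    using assms by unfold_locales
  let ?\<rho> = "\<pi> \<circ> transpose 1 (Suc n)"
  define d where "d i = (?\<rho> ^^ i) 1" for i
  have d0: "d 0 = 1" "d 1 = Suc n"
    using insert_max_simps(1)[OF perm n_pos] by (simp_all add: d_def)
  have dS: "d (Suc i) = c i" if "1 \<le> i" "i \<le> n" for i
    unfolding d_def c_def by (rule funpow_insert_max[OF assms(1) that])
  have "avoids231_on {..<Suc n} d \<longleftrightarrow> avoids231_on {..<n} c"
  proof
    assume L: "avoids231_on {..<Suc n} d"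
    show "avoids231_on {..<n} c"
      unfolding avoids231_on_def
    proof (intro ballI impI)
      fix i j l assume *: "i \<in> {..<n}" "j \<in> {..<n}" "l \<in> {..<n}" "i < j" "j < l" "c i < c j"
      show "c i \<le> c l"
      proof (cases "i = 0")
        case True
        then show ?thesis using c_in[of l] * by simp
      next
        case False
        then show ?thesis
          using avoids231_onD[OF L, of "Suc i" "Suc j" "Suc l"] * dS by simp
      qed
    qed
  next
    assume R: "avoids231_on {..<n} c"
    show "avoids231_on {..<Suc n} d"
      unfolding avoids231_on_def
    proof (intro ballI impI)
      fix i j l assume *: "i \<in> {..<Suc n}" "j \<in> {..<Suc n}" "l \<in> {..<Suc n}"
        "i < j" "j < l" "d i < d j"
      obtain l' where l: "l = Suc l'" "1 \<le> l'" "l' < n" using * by (cases l) auto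
      obtain j' where j: "j = Suc j'" "j' < n" using * by (cases j) auto
      consider "i = 0" | "i = 1" | i' where "i = Suc i'" "i' \<ge> 1"
        by (cases i; cases "i - 1") auto
      then show "d i \<le> d l"
      proof cases
        case 1
        then show ?thesis using d0 l dS[of l'] c_in[of l'] by simp
      next
        case 2
        then show ?thesis using d0 j dS[of j'] c_in[of j'] * by simp
      next
        case 3
        then show ?thesis
          using avoids231_onD[OF R, of i' j' l'] * l j dS[of i'] dS[of j'] dS[of l'] by simp
      qed
    qed
  qed
  then show ?thesis by (simp add: d_def[abs_def] c_def[abs_def])
qed

text \<open>The condition \<open>\<rho> (Suc n) = n\<close> mirrors \<open>\<pi> 1 = n\<close>,
  since \<open>\<rho> (Suc n) = \<pi> 1\<close>. The transposition is an involution, so composing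
  with it again undoes the insertion.\<close>

lemma avoiders_insert_max:
  assumes "n \<ge> 1"
  shows "(\<lambda>\<pi>. \<pi> \<circ> transpose 1 (Suc n)) ` avoiders n = {\<rho> \<in> avoiders (Suc n). \<rho> (Suc n) = n}"
proof (intro equalityI subsetI)
  fix \<rho> assume "\<rho> \<in> (\<lambda>\<pi>. \<pi> \<circ> transpose 1 (Suc n)) ` avoiders n"
  then obtain \<pi> where \<pi>: "\<rho> = \<pi> \<circ> transpose 1 (Suc n)" "\<pi> \<in> avoiders n" by blast
  then have cyc: "cyclic_perm n \<pi>" and av: "avoids231_on {1..n} \<pi>" by (auto simp: mem_avoiders_iff)
  have perm: "\<pi> permutes {1..n}" using cyc by (simp add: cyclic_perm_def)
  have 1: "\<pi> 1 = n" by (rule avoids231_cyclic_1[OF cyc av assms])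
  show "\<rho> \<in> {\<rho> \<in> avoiders (Suc n). \<rho> (Suc n) = n}"
    using \<pi> cyclic_perm_insert_max[OF cyc assms] avoids231_insert_max[OF perm assms 1]
      avoids231_cycle_insert_max[OF cyc assms] insert_max_simps(2)[OF perm assms] 1
    by (simp add: mem_avoiders_iff del: o_apply)
next
  fix \<rho> assume "\<rho> \<in> {\<rho> \<in> avoiders (Suc n). \<rho> (Suc n) = n}"
  then have \<rho>: "\<rho> \<in> avoiders (Suc n)" "\<rho> (Suc n) = n" by auto
  then have cyc: "cyclic_perm (Suc n) \<rho>" and av: "avoids231_on {1..Suc n} \<rho>"
    by (auto simp: mem_avoiders_iff)
  define \<pi> where "\<pi> = \<rho> \<circ> transpose 1 (Suc n)"
  have cyc': "cyclic_perm n \<pi>"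
    unfolding \<pi>_def using avoids231_cyclic_1[OF cyc av] by (intro cyclic_perm_delete_max cyc assms) simp
  then have perm: "\<pi> permutes {1..n}" by (simp add: cyclic_perm_def)
  have 1: "\<pi> 1 = n" using \<rho>(2) by (simp add: \<pi>_def)
  have \<rho>_eq: "\<rho> = \<pi> \<circ> transpose 1 (Suc n)"
    by (simp add: \<pi>_def comp_assoc)
  have "\<pi> \<in> avoiders n"
    using \<rho>(1) cyc' avoids231_insert_max[OF perm assms 1] avoids231_cycle_insert_max[OF cyc' assms]
    unfolding \<rho>_eq mem_avoiders_iff by blast
  then show "\<rho> \<in> (\<lambda>\<pi>. \<pi> \<circ> transpose 1 (Suc n)) ` avoiders n"
    using \<rho>_eq by blast
qed

lemma finite_avoiders: "finite (avoiders n)"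
  by (rule finite_subset[OF _ finite_permutations[of "{1..n}"]])
    (auto simp: mem_avoiders_iff cyclic_perm_def)

lemma card_avoiders_Suc:
  assumes "n \<ge> 1"
  shows "card (avoiders (Suc n)) = card (avoiders n) + card {\<rho> \<in> avoiders (Suc n). \<rho> (Suc n) \<noteq> n}"
proof -
  have "inj_on (\<lambda>\<pi>. \<pi> \<circ> transpose 1 (Suc n)) (avoiders n)"
  proof (rule inj_onI)
    fix \<pi> \<pi>' :: "nat \<Rightarrow> nat"
    assume "\<pi> \<circ> transpose 1 (Suc n) = \<pi>' \<circ> transpose 1 (Suc n)"
    then have "\<pi> \<circ> transpose 1 (Suc n) \<circ> transpose 1 (Suc n) =
        \<pi>' \<circ> transpose 1 (Suc n) \<circ> transpose 1 (Suc n)"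
      by (simp only:)
    then show "\<pi> = \<pi>'" by (simp add: comp_assoc)
  qed
  then have "card {\<rho> \<in> avoiders (Suc n). \<rho> (Suc n) = n} = card (avoiders n)"
    unfolding avoiders_insert_max[OF assms, symmetric] by (rule card_image)
  moreover have "card ({\<rho> \<in> avoiders (Suc n). \<rho> (Suc n) = n} \<union> {\<rho> \<in> avoiders (Suc n). \<rho> (Suc n) \<noteq> n}) =
    card {\<rho> \<in> avoiders (Suc n). \<rho> (Suc n) = n} + card {\<rho> \<in> avoiders (Suc n). \<rho> (Suc n) \<noteq> n}"
    by (rule card_Un_disjoint) (auto simp: finite_avoiders)
  moreover have "{\<rho> \<in> avoiders (Suc n). \<rho> (Suc n) = n} \<union> {\<rho> \<in> avoiders (Suc n). \<rho> (Suc n) \<noteq> n} =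
    avoiders (Suc n)"
    by blast
  ultimately show ?thesis by simp
qed

section \<open>The zigzag permutation\<close>

lemma permutesI_inj:
  assumes "finite S" "\<And>x. x \<in> S \<Longrightarrow> f x \<in> S" "inj_on f S" "\<And>x. x \<notin> S \<Longrightarrow> f x = x"
  shows "f permutes S"
proof (rule bij_imp_permutes)
  show "bij_betw f S S"
    unfolding bij_betw_def using assms(1-3) by (metis endo_inj_surj image_subsetI)
qed (rule assms(4))

text \<open>Closed form of the cycle \<open>(1, n, 2, n - 1, 3, \<dots>)\<close>. Its last entry is
  \<open>n div 2 + 1\<close>, which therefore returns to 1; points outside \<open>{1..n}\<close> are
  fixed, as \<open>permutes\<close> demands.\<close>

definition zigzag :: "nat \<Rightarrow> nat \<Rightarrow> nat" where
  "zigzag n x =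
    (if x = 0 \<or> n < x then x
     else if x < n div 2 + 1 then n + 1 - x
     else if x = n div 2 + 1 then 1
     else n + 2 - x)"

lemma zigzag_permutes: "n \<ge> 2 \<Longrightarrow> zigzag n permutes {1..n}"
proof (rule permutesI_inj)
  show "inj_on (zigzag n) {1..n}"
    by (rule inj_onI) (auto simp: zigzag_def split: if_splits)
qed (auto simp: zigzag_def)

lemma funpow_zigzag:
  assumes "n \<ge> 2" "i < n"
  shows "(zigzag n ^^ i) 1 = (if even i then i div 2 + 1 else n - i div 2)"
  using assms(2)
proof (induction i)
  case (Suc i)
  have "(zigzag n ^^ Suc i) 1 = zigzag n (if even i then i div 2 + 1 else n - i div 2)"
    using Suc by simp
  also have "\<dots> = (if even (Suc i) then Suc i div 2 + 1 else n - Suc i div 2)"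
  proof (cases "even i")
    case True
    then obtain m where m: "i = 2 * m" by blast
    \<comment> \<open>As \<open>Suc i < n\<close>, the closing entry \<open>n div 2 + 1\<close> of
      the cycle has not been reached, so the first branch of \<open>zigzag\<close> applies.\<close>
    then have "m + 1 < n div 2 + 1" "m + 1 \<le> n" using Suc.prems by auto
    then show ?thesis using m by (simp add: zigzag_def)
  next
    case False
    then obtain m where m: "i = 2 * m + 1" by (blast elim: oddE)
    then have "n - m > n div 2 + 1" using Suc.prems by linarith
    then show ?thesis using m Suc.prems by (simp add: zigzag_def)
  qed
  finally show ?case .
qed simp

text \<open>Apart from the entry 1 the word is decreasing, so every ascent starts at 1. In the cycle
  sequence each entry is either below all later ones or above all later ones.\<close>

lemma zigzag_avoiders:
  assumes "n \<ge> 2"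
  shows "zigzag n \<in> avoiders n"
  unfolding mem_avoiders_iff
proof (intro conjI)
  show "cyclic_perm n (zigzag n)"
  proof (rule cyclic_permI)
    show "{1..n} \<subseteq> range (\<lambda>i. (zigzag n ^^ i) 1)"
    proof
      fix x assume x: "x \<in> {1..n}"
      \<comment> \<open>Small values sit at the even indices in increasing order, large values at
        the odd indices in decreasing order.\<close>
      have "x = (zigzag n ^^ (if 2 * x < n + 2 then 2 * (x - 1) else 2 * (n - x) + 1)) 1"
        using x assms by (subst funpow_zigzag) auto
      then show "x \<in> range (\<lambda>i. (zigzag n ^^ i) 1)" by blast
    qed
  qed (use assms zigzag_permutes in auto)
  show "avoids231_on {1..n} (zigzag n)"
    unfolding avoids231_on_def by (auto simp: zigzag_def)
  show "avoids231_on {..<n} (\<lambda>i. (zigzag n ^^ i) 1)"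
    unfolding avoids231_on_def
  proof (intro ballI impI)
    fix i j l
    assume *: "i \<in> {..<n}" "j \<in> {..<n}" "l \<in> {..<n}" "i < j" "j < l"
      and "(zigzag n ^^ i) 1 < (zigzag n ^^ j) 1"
    then have "(if even i then i div 2 + 1 else n - i div 2) <
        (if even j then j div 2 + 1 else n - j div 2)"
      using funpow_zigzag[OF assms, of i] funpow_zigzag[OF assms, of j] by simp
    then have "(if even i then i div 2 + 1 else n - i div 2) \<le>
        (if even l then l div 2 + 1 else n - l div 2)"
      using * by (cases "even i"; cases "even j"; cases "even l") (auto elim!: evenE oddE)
    then show "(zigzag n ^^ i) 1 \<le> (zigzag n ^^ l) 1"
      using * funpow_zigzag[OF assms, of i] funpow_zigzag[OF assms, of l] by simp
  qed
qed

section \<open>Avoiders whose last entry is 2\<close>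

context cyclic_permutation
begin

text \<open>An ascent to the left of the entry 1 would be completed to a 231 by that 1.\<close>

lemma decreasing_before_1:
  assumes "avoids231_on {1..n} \<pi>" "\<pi> k = 1" "k \<le> n" "1 \<le> x" "x < y" "y \<le> k"
  shows "\<pi> y < \<pi> x"
proof (rule ccontr)
  assume "\<not> \<pi> y < \<pi> x"
  then have less: "\<pi> x < \<pi> y" using pi_eq_iff[of x y] assms by auto
  have "\<pi> x > 1" using pi_in[of x] pi_eq_iff[of x k] assms by auto
  moreover have "y < k" using less assms calculation by (cases "y = k") auto
  ultimately show False
    using avoids231_onD[OF assms(1), of x y k] assms less by auto
qed

text \<open>All values above \<open>2\<close> appear in decreasing order, so \<open>\<pi>\<close> is determined by the position \<open>k\<close>
  of \<open>1\<close>; any \<open>k\<close> other than the middle one leaves a proper subset invariant.\<close>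

lemma eq_zigzag:
  assumes n: "n \<ge> 3" and av: "avoids231_on {1..n} \<pi>" and last: "\<pi> n = 2"
  shows "\<pi> = zigzag n"
proof -
  have first: "\<pi> 1 = n" by (rule avoids231_cyclic_1[OF cyclic av n_pos])
  obtain k where k: "1 \<le> k" "k \<le> n" "\<pi> k = 1" using pi_ex[of 1] n by auto
  have kn: "k \<noteq> n" "k \<noteq> 1" using k last first n by auto
  \<comment> \<open>The final 2 would complete to a 231 any ascent that does not start at the entry
    1.\<close>
  have dec: "\<pi> l < \<pi> i" if "1 \<le> i" "i < l" "l < n" "i \<noteq> k" for i l
  proof (rule ccontr)
    assume "\<not> \<pi> l < \<pi> i"
    then have less: "\<pi> i < \<pi> l" using pi_eq_iff[of i l] that by auto
    then have "\<pi> i \<le> \<pi> n" using avoids231_onD[OF av, of i l n] that by auto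
    then show False
      using last pi_in[of i] pi_eq_iff[of i k] pi_eq_iff[of i n] k that by auto
  qed
  have low: "\<pi> i = n + 1 - i" if "1 \<le> i" "i < k" for i
    using that
  proof (induction i rule: less_induct)
    case (less i)
    have "1 \<le> n + 1 - i" "n + 1 - i \<le> n" using less.prems k by auto
    then obtain l where l: "1 \<le> l" "l \<le> n" "\<pi> l = n + 1 - i"
      using pi_ex[of "n + 1 - i"] by blast
    have "l \<noteq> k" "l \<noteq> n" using l k last less.prems kn by auto
    have "\<not> l < i" using less.IH[of l] less.prems l k by auto
    moreover have "\<not> i < l"
    proof
      assume "i < l"
      then have gt: "\<pi> i > n + 1 - i" using dec[of i l] l less.prems \<open>l \<noteq> n\<close> by auto
      \<comment> \<open>By induction the value \<open>\<pi> i\<close> is already taken at this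
        earlier position.\<close>
      define i' where "i' = n + 1 - \<pi> i"
      have "i' < i" "1 \<le> i'" "n + 1 - i' = \<pi> i"
        using gt pi_in[of i] less.prems k by (auto simp: i'_def)
      then show False using less.IH[of i'] less.prems pi_eq_iff[of i i'] by auto
    qed
    ultimately show ?case using l by (metis nat_neq_iff)
  qed
  have high: "\<pi> i = n + 2 - i" if "k < i" "i < n" for i
    using that
  proof (induction i rule: less_induct)
    case (less i)
    have "1 \<le> n + 2 - i" "n + 2 - i \<le> n" using less.prems k kn by auto
    then obtain l where l: "1 \<le> l" "l \<le> n" "\<pi> l = n + 2 - i"
      using pi_ex[of "n + 2 - i"] by blast
    have ne: "l \<noteq> k" "l \<noteq> n" using l k last less.prems kn by auto
    have "\<not> l < k" using low[of l] less.prems l k by auto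
    then have "k < l" using ne by auto
    then have "\<not> l < i" using less.IH[of l] less.prems l k by auto
    moreover have "\<not> i < l"
    proof
      assume "i < l"
      then have gt: "\<pi> i > n + 2 - i" using dec[of i l] l less.prems ne k by auto
      \<comment> \<open>The value \<open>\<pi> i\<close> is already taken: at \<open>i'\<close> if
        that lies before \<open>k\<close>, otherwise at \<open>i' + 1\<close>, because the entry 1
        shifts the rest by one.\<close>
      define i' where "i' = n + 1 - \<pi> i"
      have i': "i' + 1 < i" "1 \<le> i'" "n + 1 - i' = \<pi> i"
        using gt pi_in[of i] less.prems k by (auto simp: i'_def)
      show False
      proof (cases "i' < k")
        case True
        then show False using low[of i'] i' pi_eq_iff[of i i'] by auto
      next
        case False
        then show False using less.IH[of "i' + 1"] i' less.prems pi_eq_iff[of i "i' + 1"] by auto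
      qed
    qed
    ultimately show ?case using l by (metis nat_neq_iff)
  qed
  have high': "\<pi> i = n + 2 - i" if "k < i" "i \<le> n" for i
    using high[of i] that last by (cases "i = n") auto
  have "n \<le> 2 * k - 1"
  proof (rule ccontr)
    assume small: "\<not> n \<le> 2 * k - 1"
    \<comment> \<open>Positions before \<open>k\<close> are reflected into the upper block,
      \<open>k\<close> goes to 1, and the upper block goes back to \<open>{2..k}\<close>. If
      \<open>k\<close> is too small, \<open>k + 1\<close> falls in the gap.\<close>
    have "{1..k} \<union> {n + 2 - k..n} = {1..n}"
    proof (rule invariant_set)
      show "\<pi> ` ({1..k} \<union> {n + 2 - k..n}) \<subseteq> {1..k} \<union> {n + 2 - k..n}"
      proof safe
        fix i assume i: "i \<in> {1..k}" "\<pi> i \<notin> {n + 2 - k..n}"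
        then show "\<pi> i \<in> {1..k}" using low[of i] k by (cases "i = k") auto
      next
        fix i assume i: "i \<in> {n + 2 - k..n}" "\<pi> i \<notin> {n + 2 - k..n}"
        then have "k < i" using small by auto
        then show "\<pi> i \<in> {1..k}" using high'[of i] i by auto
      qed
    qed (use k small in auto)
    moreover have "k + 1 \<in> {1..n}" "k + 1 \<notin> {1..k} \<union> {n + 2 - k..n}" using small k by auto
    ultimately show False by blast
  qed
  moreover have "2 * k \<le> n + 2"
  proof (rule ccontr)
    assume large: "\<not> 2 * k \<le> n + 2"
    \<comment> \<open>The same two blocks exchange when \<open>k\<close> is too large, and now
      \<open>n + 2 - k\<close> falls in the gap.\<close>
    have "{1..n + 1 - k} \<union> {k..n} = {1..n}"
    proof (rule invariant_set)
      show "\<pi> ` ({1..n + 1 - k} \<union> {k..n}) \<subseteq> {1..n + 1 - k} \<union> {k..n}"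
      proof safe
        fix i assume i: "i \<in> {1..n + 1 - k}" "\<pi> i \<notin> {k..n}"
        then have "i < k" using large by auto
        then show "\<pi> i \<in> {1..n + 1 - k}" using low[of i] i k by auto
      next
        fix i assume i: "i \<in> {k..n}" "\<pi> i \<notin> {k..n}"
        then show "\<pi> i \<in> {1..n + 1 - k}" using high'[of i] k by (cases "i = k") auto
      qed
    qed (use k large in auto)
    moreover have "n + 2 - k \<in> {1..n}" "n + 2 - k \<notin> {1..n + 1 - k} \<union> {k..n}"
      using large k by auto
    ultimately show False by blast
  qed
  ultimately have k_eq: "k = n div 2 + 1" using k(1) by presburger
  show ?thesis
  proof
    fix x
    consider "x \<notin> {1..n}" | "1 \<le> x" "x < k" | "x = k" | "k < x" "x \<le> n"
      using k by force
    then show "\<pi> x = zigzag n x"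
    proof cases
      case 1
      then show ?thesis using permutes_not_in[OF perm] by (auto simp: zigzag_def)
    next
      case 2
      then show ?thesis using low[of x] k k_eq by (auto simp: zigzag_def)
    next
      case 3
      then show ?thesis using k k_eq by (auto simp: zigzag_def)
    next
      case 4
      then show ?thesis using high'[of x] k k_eq by (auto simp: zigzag_def)
    qed
  qed
qed

end

section \<open>The two sporadic avoiders\<close>

definition perm_of_list :: "nat list \<Rightarrow> nat \<Rightarrow> nat" where
  "perm_of_list w x = (if x \<in> {1..length w} then w ! (x - 1) else x)"

text \<open>Reduces membership of an explicit permutation to evaluations on finite lists;
  \<open>d\<close> is its cycle sequence, and covering \<open>{1..length w}\<close> makes it a
  single cycle.\<close>

lemma perm_of_list_in_avoiders:
  assumes "distinct w" "set w = {1..length w}" "w \<noteq> []"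
    and "map (\<lambda>i. (perm_of_list w ^^ i) 1) [0..<length w] = d" "set d = {1..length w}"
    and "avoids231_on {..<length w} ((!) w)" "avoids231_on {..<length d} ((!) d)"
  shows "perm_of_list w \<in> avoiders (length w)"
proof -
  have "one_line (length w) (perm_of_list w) = w"
    by (rule nth_equalityI) (auto simp: one_line_def perm_of_list_def simp del: upt_Suc)
  moreover have "cycle_notation (length w) (perm_of_list w) = d"
    using assms(4) by (simp add: cycle_notation_def)
  moreover have "cyclic_perm (length w) (perm_of_list w)"
  proof (rule cyclic_permI)
    show "perm_of_list w permutes {1..length w}"
    proof (rule permutesI_inj)
      show "inj_on (perm_of_list w) {1..length w}"
        by (rule inj_onI) (use assms(1) in \<open>auto simp: perm_of_list_def nth_eq_iff_index_eq\<close>)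
      fix x assume "x \<in> {1..length w}"
      then have "perm_of_list w x \<in> set w" by (auto simp: perm_of_list_def)
      then show "perm_of_list w x \<in> {1..length w}" using assms(2) by simp
    qed (auto simp: perm_of_list_def)
    show "1 \<le> length w" using assms(3) by (cases w) auto
    show "{1..length w} \<subseteq> range (\<lambda>i. (perm_of_list w ^^ i) 1)"
      unfolding assms(5)[symmetric] assms(4)[symmetric] by auto
  qed
  ultimately show ?thesis
    using assms(6,7) avoids_pattern_map_231[of "(!) w" "length w"]
      avoids_pattern_map_231[of "(!) d" "length d"]
    unfolding avoiders_def avoiding_cyclic_def map_nth by simp
qed

lemma perm_of_list_54213: "perm_of_list [5, 4, 2, 1, 3] \<in> avoiders 5"
proof -
  have "perm_of_list [5, 4, 2, 1, 3] \<in> avoiders (length [5, 4, 2, 1, 3 :: nat])"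
  proof (rule perm_of_list_in_avoiders)
    show "map (\<lambda>i. (perm_of_list [5, 4, 2, 1, 3] ^^ i) 1) [0..<length [5, 4, 2, 1, 3 :: nat]] =
        [1, 5, 3, 2, 4]"
      by (simp add: perm_of_list_def upt_rec numeral_eq_Suc)
  qed (auto simp: avoids231_on_def lessThan_Suc numeral_eq_Suc)
  then show ?thesis by (simp add: numeral_eq_Suc)
qed

lemma perm_of_list_652143: "perm_of_list [6, 5, 2, 1, 4, 3] \<in> avoiders 6"
proof -
  have "perm_of_list [6, 5, 2, 1, 4, 3] \<in> avoiders (length [6, 5, 2, 1, 4, 3 :: nat])"
  proof (rule perm_of_list_in_avoiders)
    show "map (\<lambda>i. (perm_of_list [6, 5, 2, 1, 4, 3] ^^ i) 1) [0..<length [6, 5, 2, 1, 4, 3 :: nat]] =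
        [1, 6, 3, 2, 5, 4]"
      by (simp add: perm_of_list_def upt_rec numeral_eq_Suc)
  qed (auto simp: avoids231_on_def lessThan_Suc numeral_eq_Suc)
  then show ?thesis by (simp add: numeral_eq_Suc)
qed

section \<open>Avoiders ending neither in \<open>n - 1\<close> nor in 2\<close>

context cyclic_permutation
begin

text \<open>The values of \<open>c\<close> strictly between \<open>n\<close> and \<open>n - 1\<close> are smaller than those after \<open>n - 1\<close>.
  As the entries before \<open>1\<close> decrease, \<open>n - 1\<close> has to follow \<open>2\<close> in the cycle.\<close>

lemma exceptional_cases:
  assumes n: "n \<ge> 4" and av: "avoids231_on {1..n} \<pi>" and avc: "avoids231_on {..<n} c"
    and last: "\<pi> n \<noteq> n - 1" "\<pi> n \<noteq> 2"
  shows "n = 5 \<and> \<pi> = perm_of_list [5, 4, 2, 1, 3] \<or> n = 6 \<and> \<pi> = perm_of_list [6, 5, 2, 1, 4, 3]"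
proof -
  have first: "\<pi> 1 = n" by (rule avoids231_cyclic_1[OF cyclic av n_pos])
  have c1: "c 1 = n" using c_Suc[of 0] first by simp
  define j where "j = \<pi> n"
  have c2: "c 2 = j" using c_Suc[of 1] c1 by (simp add: j_def numeral_2_eq_2)
  have c_pos: "c i \<noteq> 1" if "0 < i" "i < n" for i
    using c_eq_iff[of i 0] that by simp
  have "j \<noteq> n" using pi_eq_iff[of n 1] first n by (simp add: j_def)
  moreover have "j \<noteq> 1" using c2 c_pos[of 2] n by auto
  moreover have "j \<le> n" using c_in[of 2] c2 n by simp
  moreover have "j \<ge> 1" using c_in[of 2] c2 n by simp
  ultimately have j: "3 \<le> j" "j \<le> n - 2"
    using last by (auto simp: j_def)
  have "1 \<le> n - 1" "n - 1 \<le> n" using n by auto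
  then obtain t where t: "t < n" "c t = n - 1" using c_ex[of "n - 1"] by blast
  have t3: "t \<ge> 3"
  proof (rule ccontr)
    assume "\<not> t \<ge> 3"
    then consider "t = 0" | "t = 1" | "t = 2" by linarith
    then show False by cases (use t c1 c2 j n in auto)
  qed
  \<comment> \<open>The last entry of the cycle is also the position of the value 1 in the one-line
    notation.\<close>
  define k where "k = c (n - 1)"
  have k: "\<pi> k = 1" "1 < k" "k < n"
  proof -
    show "\<pi> k = 1" using c_Suc[of "n - 1"] c_n n by (simp add: k_def)
    have "c (n - 1) \<noteq> c 1" using c_eq_iff[of "n - 1" 1] n by simp
    then show "1 < k" "k < n"
      using c_pos[of "n - 1"] c_in[of "n - 1"] c1 n by (auto simp: k_def)
  qed
  have dec: "\<pi> y < \<pi> x" if "1 \<le> x" "x < y" "y \<le> k" for x y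
    using decreasing_before_1[OF av k(1), of x y] that k by simp
  have sep: "c a < c b" if "2 \<le> a" "a < t" "t < b" "b < n" for a b
  proof -
    have "c a \<noteq> n" using c_eq_iff[of a 1] c1 that t by auto
    moreover have "c a \<noteq> n - 1" using c_eq_iff[of a t] that t by auto
    ultimately have "c a < c t" using c_in[of a] that t by auto
    then have "c a \<le> c b" using avoids231_onD[OF avc, of a t b] that t by auto
    then show ?thesis using c_eq_iff[of a b] that by auto
  qed
  define q where "q = c (t - 1)"
  have pi_q: "\<pi> q = n - 1" using c_Suc[of "t - 1"] t t3 by (simp add: q_def)
  have "q \<noteq> 1" using c_pos[of "t - 1"] t t3 by (simp add: q_def)
  have "q \<ge> 1" using c_in[of "t - 1"] t t3 by (simp add: q_def)
  have "q < k"
  proof (cases "t = n - 1")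
    case True
    have "q \<noteq> n" using pi_q last j_def by auto
    moreover have "q \<noteq> n - 1" using c_eq_iff[of "t - 1" t] t t3 by (simp add: q_def)
    moreover have "q \<le> n" using c_in[of "t - 1"] t by (simp add: q_def)
    ultimately have "q < n - 1" by arith
    then show ?thesis using True t by (simp add: k_def)
  next
    case False
    then show ?thesis using sep[of "t - 1" "n - 1"] t t3 by (simp add: q_def k_def)
  qed
  have q2: "q = 2"
  proof (rule ccontr)
    assume "q \<noteq> 2"
    then have "n - 1 < \<pi> 2" using dec[of 2 q] pi_q \<open>q \<noteq> 1\<close> \<open>q \<ge> 1\<close> \<open>q < k\<close> by auto
    then have "\<pi> 2 = \<pi> 1" using first pi_in[of 2] n by auto
    then show False using pi_eq_iff[of 2 1] by simp
  qed
  have pi_2: "\<pi> 2 = n - 1" using pi_q q2 by simp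
  have n5: "n \<ge> 5" using j by simp
  then have pos: "1 \<le> n - 2" "n - 2 \<le> n" "1 \<le> n - 3" "n - 3 \<le> n" by auto
  obtain x where x: "1 \<le> x" "x \<le> n" "\<pi> x = 2" using pi_ex[of 2] n by auto
  have x_ne: "x \<noteq> n" "x \<noteq> 1" "x \<noteq> 2" using x last first pi_2 n5 by auto
  show ?thesis
  proof (cases "t = n - 1")
    case True
    then have k_eq: "k = n - 1" using t by (simp add: k_def)
    \<comment> \<open>The word decreases up to the 1 at position \<open>n - 1\<close>, so the 2
      stands right before it.\<close>
    have "x = n - 2"
    proof (rule ccontr)
      assume "x \<noteq> n - 2"
      moreover have "x \<noteq> n - 1" using x k k_eq by auto
      ultimately have "x < n - 2" using x x_ne by simp
      then have "\<pi> (n - 2) < 2" using dec[of x "n - 2"] x k_eq by simp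
      then have "\<pi> (n - 2) = \<pi> k" using pi_in[of "n - 2"] k pos by auto
      then show False using pi_eq_iff k_eq n5 by auto
    qed
    then have pi_n2: "\<pi> (n - 2) = 2" using x by simp
    have c_n2: "c (n - 2) = 2" using q2 True by (simp add: q_def numeral_2_eq_2)
    have "Suc (n - 3) = n - 2" using n5 by simp
    then have "\<pi> (c (n - 3)) = c (n - 2)" using c_Suc[of "n - 3"] by simp
    then have c_n3: "c (n - 3) = n - 2" using pi_n2 c_n2 pi_eq_iff by metis
    \<comment> \<open>The cycle ends in \<open>n - 2, 2, n - 1\<close>. For larger \<open>n\<close>
      the entry \<open>j\<close> precedes these, and \<open>j, n - 2, 2\<close> is a 231.\<close>
    have "n = 5"
    proof (rule ccontr)
      assume "n \<noteq> 5"
      then have n6: "n \<ge> 6" using n5 by simp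
      have "c 2 \<noteq> c (n - 3)" using c_eq_iff[of 2 "n - 3"] n6 by simp
      then have "c 2 < c (n - 3)" using c2 c_n3 j by simp
      then have "c 2 \<le> c (n - 2)" using avoids231_onD[OF avc, of 2 "n - 3" "n - 2"] n6 by simp
      then show False using c2 c_n2 j by simp
    qed
    moreover have "\<pi> = perm_of_list [5, 4, 2, 1, 3]"
    proof
      fix y :: nat
      consider "y = 0 \<or> y > 5" | "y = 1" | "y = 2" | "y = 3" | "y = 4" | "y = 5" by arith
      then show "\<pi> y = perm_of_list [5, 4, 2, 1, 3] y"
        using \<open>n = 5\<close> permutes_not_in[OF perm, of y] first pi_2 pi_n2 k k_eq j
        by cases (auto simp: perm_of_list_def j_def)
    qed
    ultimately show ?thesis by simp
  next
    case False
    then have tn: "t < n - 1" "t + 1 < n" using t by auto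
    have small_S1: "c a < k" if "2 \<le> a" "a < t" for a
      using sep[of a "n - 1"] that tn by (simp add: k_def)
    have jk: "j < k" using small_S1[of 2] c2 t3 by simp
    have kn2: "k \<le> n - 2"
      using c_eq_iff[of "n - 1" t] tn t k by (auto simp: k_def)
    \<comment> \<open>Only \<open>k\<close> may follow \<open>n - 1\<close> in the cycle. Otherwise
      the predecessor \<open>u\<close> of \<open>k\<close> gives the 231 formed by \<open>k\<close>,
      \<open>\<pi> (n - 1)\<close> and \<open>j\<close> at positions \<open>u\<close>,
      \<open>n - 1\<close>, \<open>n\<close>.\<close>
    have t_eq: "t = n - 2"
    proof (rule ccontr)
      assume "t \<noteq> n - 2"
      then have tn': "t < n - 2" "t + 2 < n" using tn by auto
      define u where "u = c (n - 2)"
      have "\<pi> u = k" using c_Suc[of "n - 2"] tn' by (simp add: u_def k_def Suc_diff_Suc numeral_2_eq_2)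
      have ne: "u \<noteq> n" "u \<noteq> n - 1" "1 \<le> u" "u \<le> n"
        using c_eq_iff[of "n - 2" 1] c_eq_iff[of "n - 2" t] c_in[of "n - 2"] c1 t tn' n5
        by (auto simp: u_def)
      have succ: "\<pi> (n - 1) = c (t + 1)" using c_Suc[of t] t by simp
      have "k \<le> \<pi> (n - 1)"
      proof (rule ccontr)
        assume "\<not> k \<le> \<pi> (n - 1)"
        then have less: "c (t + 1) < k" using succ by simp
        define y where "y = c (t + 1)"
        have "3 \<le> y" using sep[of 2 "t + 1"] c2 j tn t3 by (simp add: y_def)
        have pi_y: "\<pi> y = c (t + 2)" using c_Suc[of "t + 1"] by (simp add: y_def)
        \<comment> \<open>As \<open>j \<ge> 3\<close>, the value 3 lies between \<open>n\<close> and
          \<open>n - 1\<close> in the cycle, and not last there, since 2 is. So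
          \<open>\<pi> 3\<close> lies there too and is below \<open>\<pi> y\<close>, against the
          decrease before position \<open>k\<close>.\<close>
        obtain b where b: "b < n" "c b = 3" using c_ex[of 3] n by auto
        have "\<not> t < b" using sep[of 2 b] b c2 j t3 by auto
        moreover have "b \<noteq> t" using b t n5 by auto
        ultimately have "b < t" by simp
        moreover have "b \<noteq> 0" using b n5 by (cases b) auto
      moreover have "b \<noteq> 1" using b c1 n5 by (cases "b = 1") auto
        moreover have "b \<noteq> t - 1" using b q2 by (auto simp: q_def)
        ultimately have "2 \<le> b" "b + 1 < t" by auto
        then have "c (b + 1) < c (t + 2)" using sep[of "b + 1" "t + 2"] tn' by simp
        then have "\<pi> 3 < \<pi> y" using c_Suc[of b] b pi_y by simp
        moreover have "\<pi> y \<le> \<pi> 3" using dec[of 3 y] \<open>3 \<le> y\<close> less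
          by (cases "y = 3") (auto simp: y_def)
        ultimately show False by simp
      qed
      moreover have "\<pi> (n - 1) \<noteq> k"
        using c_eq_iff[of "t + 1" "n - 1"] succ tn' by (simp add: k_def)
      ultimately have "\<pi> u < \<pi> (n - 1)" using \<open>\<pi> u = k\<close> by simp
      then have "\<pi> u \<le> \<pi> n" using avoids231_onD[OF av, of u "n - 1" n] ne n5 by auto
      then show False using \<open>\<pi> u = k\<close> jk by (simp add: j_def)
    qed
    \<comment> \<open>The value \<open>n - 2\<close> must be the last cycle entry, because the
      entries between \<open>n\<close> and \<open>n - 1\<close> are below
      \<open>k \<le> n - 2\<close>.\<close>
    have "k = n - 2"
    proof (rule ccontr)
      assume "k \<noteq> n - 2"
      obtain b where b: "b < n" "c b = n - 2" using c_ex[of "n - 2"] pos by blast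
      have "b \<noteq> n - 1" using b \<open>k \<noteq> n - 2\<close> by (auto simp: k_def)
      moreover have "b \<noteq> t" using b t n5 by auto
      moreover have "b \<noteq> 0" using b n5 by (cases b) auto
      moreover have "b \<noteq> 1" using b c1 n5 by (cases "b = 1") auto
      ultimately have "c b < k" using small_S1[of b] b t_eq by auto
      then show False using b kn2 by simp
    qed
    have pi_n1: "\<pi> (n - 1) = n - 2"
      using c_Suc[of t] t t_eq \<open>k = n - 2\<close> n5 by (simp add: k_def Suc_diff_Suc numeral_2_eq_2)
    \<comment> \<open>Otherwise the values \<open>n - 3\<close>, \<open>n - 2\<close> and
      \<open>j\<close> form a 231 ending in the last two positions.\<close>
    have j_eq: "j = n - 3"
    proof (rule ccontr)
      assume "j \<noteq> n - 3"
      then have jn: "j < n - 3" using jk \<open>k = n - 2\<close> by simp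
      obtain u where u: "1 \<le> u" "u \<le> n" "\<pi> u = n - 3" using pi_ex[of "n - 3"] pos by blast
      have "u \<noteq> n" "u \<noteq> n - 1" using u pi_n1 jn n5 by (auto simp: j_def)
      then have "\<pi> u \<le> \<pi> n"
        using avoids231_onD[OF av, of u "n - 1" n] u pi_n1 n5 by auto
      then show False using u jn by (simp add: j_def)
    qed
    have "x = n - 3"
    proof (rule ccontr)
      assume "x \<noteq> n - 3"
      moreover have "x \<noteq> n - 1" using x pi_n1 j_eq j by auto
      moreover have "x \<noteq> n - 2" using x k \<open>k = n - 2\<close> by auto
      ultimately have "x < n - 3" using x x_ne by simp
      then have "\<pi> (n - 3) < 2" using dec[of x "n - 3"] x \<open>k = n - 2\<close> by simp
      then have "\<pi> (n - 3) = \<pi> k" using pi_in[of "n - 3"] k pos by auto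
      then show False using pi_eq_iff \<open>k = n - 2\<close> n5 by auto
    qed
    \<comment> \<open>The cycle starts \<open>1, n, n - 3, 2\<close>, and 2 is followed by
      \<open>n - 1\<close> at index \<open>t = n - 2\<close>. Hence \<open>t = 4\<close>.\<close>
    then have "\<pi> (c 2) = 2" using x c2 j_eq by simp
    then have "c 3 = 2" using c_Suc[of 2] by (simp add: numeral_eq_Suc)
    then have "t - 1 = 3" using c_eq_iff[of "t - 1" 3] q2 t t3 n5 by (simp add: q_def)
    then have n6: "n = 6" using t_eq by simp
    have "\<pi> = perm_of_list [6, 5, 2, 1, 4, 3]"
    proof
      fix y :: nat
      consider "y = 0 \<or> y > 6" | "y = 1" | "y = 2" | "y = 3" | "y = 4" | "y = 5" | "y = 6" by arith
      then show "\<pi> y = perm_of_list [6, 5, 2, 1, 4, 3] y"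
        using n6 permutes_not_in[OF perm, of y] first pi_2 x \<open>x = n - 3\<close> k \<open>k = n - 2\<close> pi_n1 j_eq
        by cases (auto simp: perm_of_list_def j_def)
    qed
    with n6 show ?thesis by simp
  qed
qed

end

section \<open>Counting by the recursion on the size\<close>

lemma avoiders_3: "avoiders 3 = {zigzag 3}"
proof (intro equalityI subsetI)
  fix \<pi> assume "\<pi> \<in> avoiders 3"
  then have cyc: "cyclic_perm 3 \<pi>" and av: "avoids231_on {1..3} \<pi>"
    by (simp_all only: mem_avoiders_iff)
  interpret cyclic_permutation 3 \<pi>
    using cyc by unfold_locales auto
  have "\<pi> 1 = 3" by (rule avoids231_cyclic_1[OF cyc av]) simp
  then have "c 2 = \<pi> 3"
    using c_Suc[of 0] c_Suc[of 1] by (simp add: numeral_2_eq_2)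
  then have "\<pi> 3 \<noteq> 1" "\<pi> 3 \<noteq> 3"
    using c_eq_iff[of 2 0] pi_eq_iff[of 3 1] \<open>\<pi> 1 = 3\<close> by auto
  then have "\<pi> 3 = 2" using pi_in[of 3] by auto
  then show "\<pi> \<in> {zigzag 3}" using eq_zigzag[OF _ av] by simp
qed (simp add: zigzag_avoiders)

definition exceptional :: "nat \<Rightarrow> (nat \<Rightarrow> nat) set" where
  "exceptional n =
    (if n = 5 then {perm_of_list [5, 4, 2, 1, 3]}
     else if n = 6 then {perm_of_list [6, 5, 2, 1, 4, 3]}
     else {})"

text \<open>For \<open>n \<ge> 4\<close> the final 2 of \<open>zigzag n\<close> differs from
  \<open>n - 1\<close>; at size 3 the two coincide.\<close>

lemma avoiders_last_neq:
  assumes "n \<ge> 4"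
  shows "{\<pi> \<in> avoiders n. \<pi> n \<noteq> n - 1} = insert (zigzag n) (exceptional n)"
proof (intro equalityI subsetI)
  fix \<pi> assume "\<pi> \<in> {\<pi> \<in> avoiders n. \<pi> n \<noteq> n - 1}"
  then have cyc: "cyclic_perm n \<pi>" and av: "avoids231_on {1..n} \<pi>"
    and avc: "avoids231_on {..<n} (\<lambda>i. (\<pi> ^^ i) 1)" and neq: "\<pi> n \<noteq> n - 1"
    by (auto simp only: mem_avoiders_iff)
  interpret cyclic_permutation n \<pi>
    using cyc assms by unfold_locales auto
  have "c = (\<lambda>i. (\<pi> ^^ i) 1)" by (simp add: c_def[abs_def])
  then show "\<pi> \<in> insert (zigzag n) (exceptional n)"
    using exceptional_cases[OF assms av] avc neq eq_zigzag[OF _ av] assms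
    by (cases "\<pi> n = 2") (auto simp: exceptional_def)
next
  fix \<pi> assume "\<pi> \<in> insert (zigzag n) (exceptional n)"
  then show "\<pi> \<in> {\<pi> \<in> avoiders n. \<pi> n \<noteq> n - 1}"
    using zigzag_avoiders[of n] perm_of_list_54213 perm_of_list_652143 assms
    by (auto simp: exceptional_def zigzag_def perm_of_list_def split: if_splits)
qed

lemma card_avoiders_step:
  assumes "n \<ge> 4"
  shows "card (avoiders n) = card (avoiders (n - 1)) + 1 + card (exceptional n)"
proof -
  have "n > n div 2 + 1" using assms by linarith
  then have "zigzag n n = 2" by (simp add: zigzag_def)
  then have "zigzag n \<notin> exceptional n"
    by (auto simp: exceptional_def perm_of_list_def split: if_splits)
  then have "card {\<pi> \<in> avoiders n. \<pi> n \<noteq> n - 1} = 1 + card (exceptional n)"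
    unfolding avoiders_last_neq[OF assms] by (simp add: exceptional_def)
  then show ?thesis
    using card_avoiders_Suc[of "n - 1"] assms by simp
qed

lemma card_avoiders: "n \<ge> 6 \<Longrightarrow> card (avoiders n) = n"
proof (induction n rule: dec_induct)
  case base
  \<comment> \<open>The counts for sizes 3 to 6 are 1, 2, 4, 6: the two exceptional permutations
    bring the count up to \<open>n\<close> exactly at 6.\<close>
  have "card (avoiders 3) = 1" by (simp add: avoiders_3)
  then show ?case
    using card_avoiders_step[of 4] card_avoiders_step[of 5] card_avoiders_step[of 6]
    by (simp add: exceptional_def)
next
  case (step n)
  then show ?case
    using card_avoiders_step[of "Suc n"] by (simp add: exceptional_def)
qed

theorem theorem4p16:
  fixes n :: nat
  assumes "n \<ge> 6"
  shows "num_avoiding_cyclic n [2, 3, 1] [2, 3, 1] = n"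
  using card_avoiders[OF assms] by (simp add: num_avoiding_cyclic_def avoiders_def)

end
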